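(* Let the integer $d\ge 2$ and the real number $\lambda$ be chosen satisfying $\sqrt[d]{d}-1\le\lambda\le\sqrt{2}-1$. Then $$\delta_d(\lambda)\le\sup_{n}\delta_d(n,\lambda)\le\frac{2d+4}{\left(2-(1+\lambda)^2\right)d+4}(1+\lambda)^{-d}\le\frac{d+2}{2}(1+\lambda)^{-d}\le 1,$$ where the supremum is over all integers $n>1$.
   Context: $\mathbb{E}^d$ is $d$-dimensional Euclidean space, $\mathbf{B}^d$ its closed unit ball centered at the origin, $\mathrm{vol}_d$ the $d$-dimensional volume, $\omega_d=\mathrm{vol}_d(\mathbf{B}^d)$. A packing of $n>1$ unit balls is a family $\mathcal{P}^n=\{\mathbf{c}_i+\mathbf{B}^d: 1\le i\le n\}$ with $\|\mathbf{c}_j-\mathbf{c}_k\|\ge 2$ for all $1\le j<k\le n$. For $\lambda>0$, $$\delta_d(n,\lambda):=\max_{\mathcal{P}^n}\frac{n\omega_d}{\mathrm{vol}_d\left(\bigcup_{i=1}^n(\mathbf{c}_i+(1+\lambda)\mathbf{B}^d)\right)},\qquad \delta_d(\lambda):=\limsup_{n\to+\infty}\delta_d(n,\lambda),$$ the maximum being over all packings $\mathcal{P}^n$ of $n$ unit balls in $\mathbb{E}^d$. *)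

theory Defs
  imports "HOL-Analysis.Analysis"
begin

definition unit_ball_packing :: "nat \<Rightarrow> (nat \<Rightarrow> 'a::euclidean_space) \<Rightarrow> bool" where
  "unit_ball_packing n c \<longleftrightarrow> n > 1 \<and> (\<forall>j k. 1 \<le> j \<and> j < k \<and> k \<le> n \<longrightarrow> 2 \<le> norm (c j - c k))"

definition soft_density :: "nat \<Rightarrow> real \<Rightarrow> (nat \<Rightarrow> 'a::euclidean_space) \<Rightarrow> real" where
  "soft_density n lam c =
     real n * measure lebesgue (cball (0::'a) 1) /
     measure lebesgue (\<Union>i\<in>{1..n}. cball (c i) (1 + lam))"

(* The type argument only selects the ambient Euclidean space 'a, of dimension DIM('a).
   The maximum exists for n > 1 and lam > 0; see soft_packing_density_attained below. *)
definition soft_packing_density :: "'a::euclidean_space itself \<Rightarrow> nat \<Rightarrow> real \<Rightarrow> real" where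
  "soft_packing_density _ n lam =
     (GREATEST x. \<exists>c :: nat \<Rightarrow> 'a. unit_ball_packing n c \<and> x = soft_density n lam c)"

(* Extended reals, so that the upper limit exists without a boundedness side condition. *)
definition soft_packing_limit_density :: "'a::euclidean_space itself \<Rightarrow> real \<Rightarrow> ereal" where
  "soft_packing_limit_density E lam = limsup (\<lambda>n. ereal (soft_packing_density E n lam))"


definition sep_on :: "nat set \<Rightarrow> (nat \<Rightarrow> 'a::euclidean_space) \<Rightarrow> bool" where
  "sep_on I c \<longleftrightarrow> (\<forall>j\<in>I. \<forall>k\<in>I. j \<noteq> k \<longrightarrow> 2 \<le> dist (c j) (c k))"

definition union_vol :: "real \<Rightarrow> nat set \<Rightarrow> (nat \<Rightarrow> 'a::euclidean_space) \<Rightarrow> real" where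
  "union_vol r I c = measure lebesgue (\<Union>i\<in>I. cball (c i) r)"

lemma unit_ball_packing_iff: "unit_ball_packing n c \<longleftrightarrow> n > 1 \<and> sep_on {1..n} c"
proof -
  have "2 \<le> dist (c j) (c k)"
    if "\<forall>j k. 1 \<le> j \<and> j < k \<and> k \<le> n \<longrightarrow> 2 \<le> norm (c j - c k)" 
       "1 \<le> j" "j \<le> n" "1 \<le> k" "k \<le> n" "j \<noteq> k" for j k
    using that by (metis dist_commute dist_norm linorder_neqE_nat)
  then show ?thesis
    unfolding unit_ball_packing_def sep_on_def by (auto simp: dist_norm)
qed

lemma lmeasurable_union_cball: "finite I \<Longrightarrow> (\<Union>i\<in>I. cball (c i) r) \<in> lmeasurable"
  by (intro fmeasurable.finite_UN) auto

lemma union_vol_translate: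
  "union_vol r I (\<lambda>i. c i + a) = union_vol r I (c :: nat \<Rightarrow> 'a::euclidean_space)"
proof -
  have "(\<Union>i\<in>I. cball (c i + a) r) = (+) a ` (\<Union>i\<in>I. cball (c i) r)"
    by (simp add: image_UN cball_translation add.commute)
  then show ?thesis
    by (simp add: union_vol_def measure_translation)
qed

lemma union_vol_cong: "(\<And>i. i \<in> I \<Longrightarrow> c i = c' i) \<Longrightarrow> union_vol r I c = union_vol r I c'"
  by (simp add: union_vol_def)

lemma packing_gap:
  fixes c :: "nat \<Rightarrow> 'a::euclidean_space"
  assumes r: "r > 0" and I: "finite I" "p \<in> I" "q \<in> I"
    and q: "dist (c p) (c q) > 2 * r * real (card I)"
  obtains A B where "I = A \<union> B" "A \<inter> B = {}" "A \<noteq> {}" "B \<noteq> {}"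
    "\<And>i j. i \<in> A \<Longrightarrow> j \<in> B \<Longrightarrow> dist (c i) (c j) > 2 * r"
proof -
  define h where "h i = nat \<lceil>dist (c p) (c i) / (2 * r)\<rceil> - 1" for i
  have "card (h ` (I - {p})) \<le> card (I - {p})" 
    using I by (intro card_image_le) auto
  also have "\<dots> < card {..<card I}"
    using card_gt_0_iff[of I] I by auto
  finally obtain k where k: "k < card I" "k \<notin> h ` (I - {p})"
    by (metis I(1) card_mono finite_Diff finite_imageI lessThan_iff not_less subsetI)
  let ?A = "{i\<in>I. dist (c p) (c i) \<le> 2 * r * k}"
  let ?B = "{i\<in>I. dist (c p) (c i) > 2 * r * (k + 1)}"
  have le: "2 * r * k \<le> 2 * r * (k + 1)" "2 * r * (real k + 1) \<le> 2 * r * card I"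
    using r k(1) by auto
  have "i \<in> ?A \<union> ?B" if "i \<in> I" for i
  proof (rule ccontr)
    assume no: "i \<notin> ?A \<union> ?B"
    then have "i \<noteq> p" using that r by auto
    moreover have "real k < dist (c p) (c i) / (2 * r)" "dist (c p) (c i) / (2 * r) \<le> real k + 1"
      using no that r by (auto simp: field_simps)
    then have "\<lceil>dist (c p) (c i) / (2 * r)\<rceil> = int k + 1"
      by (simp add: ceiling_eq_iff)
    then have "h i = k" by (simp add: h_def nat_add_distrib)
    ultimately show False using k(2) that by auto
  qed
  then have "I = ?A \<union> ?B" by blast
  moreover have "?A \<inter> ?B = {}" using le by fastforce
  moreover have "p \<in> ?A" using I r by simp
  moreover have "q \<in> ?B" using I q le by (simp add: algebra_simps)
  moreover have "dist (c i) (c j) > 2 * r" if "i \<in> ?A" "j \<in> ?B" for i j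
    using that dist_triangle[of "c p" "c j" "c i"] by (simp add: algebra_simps)
  ultimately show ?thesis using that[of ?A ?B] by blast
qed

lemma packing_bounded_replacement:
  assumes r: "r > 0"
  shows "\<exists>R. \<forall>I c. finite I \<and> card I = n \<and> sep_on I (c :: nat \<Rightarrow> 'a::euclidean_space) \<longrightarrow>
          (\<exists>c' :: nat \<Rightarrow> 'a. sep_on I c' \<and> c' ` I \<subseteq> cball 0 R \<and> union_vol r I c' \<le> union_vol r I c)"
proof (induction n rule: less_induct)
  case (less n)
  have "\<forall>m. \<exists>R. m < n \<longrightarrow> (\<forall>I c. finite I \<and> card I = m \<and> sep_on I (c :: nat \<Rightarrow> 'a) \<longrightarrow>
          (\<exists>c' :: nat \<Rightarrow> 'a. sep_on I c' \<and> c' ` I \<subseteq> cball 0 R \<and> union_vol r I c' \<le> union_vol r I c))"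
    using less by simp
  then obtain R where R': "\<forall>m. m < n \<longrightarrow> (\<forall>I c. finite I \<and> card I = m \<and> sep_on I (c :: nat \<Rightarrow> 'a) \<longrightarrow>
          (\<exists>c' :: nat \<Rightarrow> 'a. sep_on I c' \<and> c' ` I \<subseteq> cball 0 (R m) \<and> union_vol r I c' \<le> union_vol r I c))"
    by (rule choice[THEN exE])
  have R: "\<exists>c' :: nat \<Rightarrow> 'a. sep_on I c' \<and> c' ` I \<subseteq> cball 0 (R m) \<and> union_vol r I c' \<le> union_vol r I c"
    if "m < n" "finite I" "card I = m" "sep_on I c" for m I and c :: "nat \<Rightarrow> 'a"
    using R' that by simp
  define S where "S = (\<Sum>m<n. \<bar>R m\<bar>)"
  have S: "R m \<le> S" if "m < n" for m
  proof -
    have "\<bar>R m\<bar> \<le> S" unfolding S_def using that by (intro member_le_sum) auto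
    then show ?thesis by linarith
  qed
  have S0: "S \<ge> 0" by (simp add: S_def sum_nonneg)
  obtain v :: 'a where v: "norm v = 2 * S + 2"
    using vector_choose_size[of "2 * S + 2"] S0 by auto
  have "\<exists>c' :: nat \<Rightarrow> 'a. sep_on I c' \<and> c' ` I \<subseteq> cball 0 (3 * S + 2 + 2 * r * n) \<and>
          union_vol r I c' \<le> union_vol r I c"
    if I: "finite I" "card I = n" "sep_on I c" for I and c :: "nat \<Rightarrow> 'a"
  proof (cases "\<exists>p\<in>I. \<exists>q\<in>I. dist (c p) (c q) > 2 * r * n")
    case False
    show ?thesis
    proof (cases "I = {}")
      case True
      then show ?thesis by (auto simp: sep_on_def)
    next
      case ne: False
      then obtain p where p: "p \<in> I" by blast
      let ?c = "\<lambda>i. c i + (- c p)"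
      have "sep_on I ?c" using I(3) by (simp add: sep_on_def dist_norm)
      moreover have "norm (?c i) \<le> 3 * S + 2 + 2 * r * n" if "i \<in> I" for i
      proof -
        have "dist (c p) (c i) \<le> 2 * r * n" using False p that by force
        then show ?thesis using S0 by (simp add: dist_norm norm_minus_commute)
      qed
      ultimately show ?thesis
        using union_vol_translate[of r I c "- c p"] by (intro exI[of _ ?c]) auto
    qed
  next
    case True
    then obtain p q where pq: "p \<in> I" "q \<in> I" "dist (c p) (c q) > 2 * r * card I"
      using I(2) by blast
    from packing_gap[OF r I(1) pq] obtain A B where
      AB: "I = A \<union> B" "A \<inter> B = {}" "A \<noteq> {}" "B \<noteq> {}"
        "\<And>i j. i \<in> A \<Longrightarrow> j \<in> B \<Longrightarrow> dist (c i) (c j) > 2 * r"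
      by metis
    have fin: "finite A" "finite B" using I AB by auto
    have card: "card A < n" "card B < n"
      using AB fin I by (auto intro!: psubset_card_mono)
    have sep: "sep_on A c" "sep_on B c" using I AB by (auto simp: sep_on_def)
    obtain a :: "nat \<Rightarrow> 'a" where a: "sep_on A a" "a ` A \<subseteq> cball 0 (R (card A))" "union_vol r A a \<le> union_vol r A c"
      using R[OF card(1) fin(1) refl sep(1)] by blast
    obtain b :: "nat \<Rightarrow> 'a" where b: "sep_on B b" "b ` B \<subseteq> cball 0 (R (card B))" "union_vol r B b \<le> union_vol r B c"
      using R[OF card(2) fin(2) refl sep(2)] by blast
    have na: "norm (a i) \<le> S" if "i \<in> A" for i
      using a(2) that S[OF card(1)] by force
    have nb: "norm (b i) \<le> S" if "i \<in> B" for i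
      using b(2) that S[OF card(2)] by force
    define w where "w i = (if i \<in> A then a i else b i + v)" for i
    have wA: "w i = a i" if "i \<in> A" for i using that by (simp add: w_def)
    have wB: "w i = b i + v" if "i \<in> B" for i using that AB(2) by (auto simp: w_def)
    have far: "2 \<le> dist (a i) (b j + v)" if "i \<in> A" "j \<in> B" for i j
    proof -
      have "norm v \<le> norm (b j + v - a i) + norm (a i) + norm (b j)"
        using norm_triangle_ineq4[of "b j + v - a i" "b j - a i"] norm_triangle_ineq4[of "b j" "a i"]
        by simp
      then show ?thesis using na[OF that(1)] nb[OF that(2)] v
        by (simp add: dist_norm norm_minus_commute)
    qed
    have "sep_on I w"
      unfolding sep_on_def
    proof (intro ballI impI)
      fix j k assume "j \<in> I" "k \<in> I" "j \<noteq> k"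
      then consider "j \<in> A" "k \<in> A" | "j \<in> A" "k \<in> B" | "j \<in> B" "k \<in> A" | "j \<in> B" "k \<in> B"
        using AB(1) by blast
      then show "2 \<le> dist (w j) (w k)"
      proof cases
        case 1 then show ?thesis using a(1) \<open>j \<noteq> k\<close> by (simp add: wA sep_on_def)
      next
        case 2 then show ?thesis using far by (simp add: wA wB)
      next
        case 3 then show ?thesis using far[of k j] by (simp add: wA wB dist_commute)
      next
        case 4 then show ?thesis using b(1) \<open>j \<noteq> k\<close> by (simp add: wB sep_on_def)
      qed
    qed
    moreover have "norm (w i) \<le> 3 * S + 2 + 2 * r * n" if "i \<in> I" for i
    proof -
      have "2 * r * n \<ge> 0" using r by simp
      moreover have "norm (w i) \<le> 3 * S + 2"
      proof (cases "i \<in> A")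
        case True then show ?thesis using na[OF True] S0 by (simp add: wA)
      next
        case False
        then have "i \<in> B" using that AB(1) by blast
        then show ?thesis using nb norm_triangle_ineq[of "b i" v] v by (fastforce simp: wB)
      qed
      ultimately show ?thesis by linarith
    qed
    moreover have "union_vol r I w \<le> union_vol r I c"
    proof -
      have "union_vol r I w \<le> union_vol r A w + union_vol r B w"
        unfolding union_vol_def AB(1) UN_Un
        by (intro measure_Un_le) (auto intro: fmeasurableD lmeasurable_union_cball fin)
      also have "\<dots> = union_vol r A a + union_vol r B (\<lambda>i. b i + v)"
        using union_vol_cong[of A w a r] union_vol_cong[of B w "\<lambda>i. b i + v" r] wA wB by simp
      also have "\<dots> \<le> union_vol r A c + union_vol r B c"
        using a b by (simp add: union_vol_translate)
      also have "\<dots> = union_vol r I c"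
      proof -
        have "cball (c i) r \<inter> cball (c j) r = {}" if "i \<in> A" "j \<in> B" for i j
          using AB(5)[OF that] by (intro disjoint_cballI) simp
        then have "(\<Union>i\<in>A. cball (c i) r) \<inter> (\<Union>i\<in>B. cball (c i) r) = {}" by blast
        then show ?thesis
          unfolding union_vol_def AB(1) UN_Un
          by (simp add: measure_Un3 lmeasurable_union_cball fin)
      qed
      finally show ?thesis .
    qed
    ultimately show ?thesis by (intro exI[of _ w]) auto
  qed
  then show ?case by (intro exI[of _ "3 * S + 2 + 2 * r * n"] allI impI) simp
qed

lemma bounded_seq_family_subseq:
  fixes f :: "nat \<Rightarrow> nat \<Rightarrow> 'a::euclidean_space"
  assumes "finite I" "\<And>i k. i \<in> I \<Longrightarrow> f k i \<in> cball 0 R"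
  shows "\<exists>s l. strict_mono s \<and> (\<forall>i\<in>I. (\<lambda>k. f (s k) i) \<longlonglongrightarrow> l i)"
  using assms
proof (induction I)
  case empty
  then show ?case by (auto intro: strict_mono_id[unfolded id_def] exI[of _ "\<lambda>x. x"] simp: strict_mono_def)
next
  case (insert j I)
  then obtain s l where s: "strict_mono s" "\<forall>i\<in>I. (\<lambda>k. f (s k) i) \<longlonglongrightarrow> l i" by auto
  have "\<forall>k. f (s k) j \<in> cball 0 R" using insert by blast
  with compact_cball[of "0::'a" R] obtain x t where
    t: "strict_mono t" "((\<lambda>k. f (s k) j) \<circ> t) \<longlonglongrightarrow> x"
    unfolding compact_def by metis
  have "(\<lambda>k. f (s (t k)) i) \<longlonglongrightarrow> (l(j := x)) i" if "i \<in> insert j I" for i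
  proof (cases "i = j")
    case True then show ?thesis using t by (simp add: o_def)
  next
    case False
    then show ?thesis using that s(2) LIMSEQ_subseq_LIMSEQ[OF _ t(1), of "\<lambda>k. f (s k) i" "l i"]
      by (simp add: o_def)
  qed
  moreover have "strict_mono (\<lambda>k. s (t k))" using s t by (simp add: strict_mono_def)
  ultimately show ?case by blast
qed

lemma union_vol_lower_limit:
  fixes f :: "nat \<Rightarrow> nat \<Rightarrow> 'a::euclidean_space"
  assumes I: "finite I" and lim: "\<And>i. i \<in> I \<Longrightarrow> (\<lambda>k. f k i) \<longlonglongrightarrow> l i"
    and V: "(\<lambda>k. union_vol r I (f k)) \<longlonglongrightarrow> V" and r: "r > 0"
  shows "union_vol r I l \<le> V"
proof -
  let ?B = "\<lambda>m. \<Union>i\<in>I. cball (l i) (r - inverse (real (Suc m)))"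
  have lm: "?B m \<in> lmeasurable" for m by (rule lmeasurable_union_cball[OF I])
  have le: "measure lebesgue (?B m) \<le> V" for m
  proof -
    have "\<forall>\<^sub>F k in sequentially. \<forall>i\<in>I. dist (f k i) (l i) < inverse (real (Suc m))"
      using I lim by (auto intro!: eventually_ball_finite tendstoD)
    then have "\<forall>\<^sub>F k in sequentially. measure lebesgue (?B m) \<le> union_vol r I (f k)"
    proof eventually_elim
      case (elim k)
      have "cball (l i) (r - inverse (real (Suc m))) \<subseteq> cball (f k i) r" if "i \<in> I" for i
      proof
        fix x assume "x \<in> cball (l i) (r - inverse (real (Suc m)))"
        then have "dist (l i) x \<le> r - inverse (real (Suc m))" by simp
        moreover have "dist (f k i) (l i) < inverse (real (Suc m))" using elim that by blast
        ultimately have "dist (f k i) x \<le> r"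
          using dist_triangle[of "f k i" x "l i"] by linarith
        then show "x \<in> cball (f k i) r" by simp
      qed
      then show ?case unfolding union_vol_def
        by (intro measure_mono_fmeasurable lmeasurable_union_cball fmeasurableD[OF lm] I) blast
    qed
    then show ?thesis using tendsto_lowerbound[OF V] by simp
  qed
  have inc: "incseq ?B"
  proof (intro incseq_SucI UN_mono subset_refl cball_subset_cball_iff[THEN iffD2])
    fix m i
    have "inverse (real (Suc (Suc m))) \<le> inverse (real (Suc m))"
      by (intro le_imp_inverse_le) auto
    then show "dist (l i) (l i) + (r - inverse (real (Suc m))) \<le> r - inverse (real (Suc (Suc m))) \<or>
        r - inverse (real (Suc m)) < 0"
      by simp
  qed
  have un: "(\<Union>m. ?B m) \<subseteq> (\<Union>i\<in>I. cball (l i) r)"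
  proof -
    have "cball (l i) (r - inverse (real (Suc m))) \<subseteq> cball (l i) r" for i m
      by (intro subset_cball) simp
    then show ?thesis by blast
  qed
  have lmU: "(\<Union>i\<in>I. cball (l i) r) \<in> lmeasurable" by (rule lmeasurable_union_cball[OF I])
  have lmI: "(\<Union>m. ?B m) \<in> lmeasurable"
    using lmU un by (rule fmeasurableI2) (auto intro: fmeasurableD[OF lm])
  then have "(\<lambda>m. measure lebesgue (?B m)) \<longlonglongrightarrow> measure lebesgue (\<Union>m. ?B m)"
    using inc lm
    by (intro Lim_measure_incseq) (auto simp: fmeasurable_def)
  then have leV: "measure lebesgue (\<Union>m. ?B m) \<le> V"
    using le by (intro LIMSEQ_le_const2) auto
  have neg: "negligible (\<Union>i\<in>I. sphere (l i) r)"
    using I by (intro negligible_Union) (auto intro: negligible_sphere)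
  have "(\<Union>i\<in>I. cball (l i) r) \<subseteq> (\<Union>m. ?B m) \<union> (\<Union>i\<in>I. sphere (l i) r)"
  proof
    fix x assume "x \<in> (\<Union>i\<in>I. cball (l i) r)"
    then obtain i where i: "i \<in> I" "dist (l i) x \<le> r" by auto
    show "x \<in> (\<Union>m. ?B m) \<union> (\<Union>i\<in>I. sphere (l i) r)"
    proof (cases "dist (l i) x = r")
      case True then show ?thesis using i by auto
    next
      case False
      then obtain m where "inverse (real (Suc m)) < r - dist (l i) x"
        using i reals_Archimedean[of "r - dist (l i) x"] by auto
      then have "x \<in> cball (l i) (r - inverse (real (Suc m)))" by simp
      then show ?thesis using i by blast
    qed
  qed
  then have "measure lebesgue (\<Union>i\<in>I. cball (l i) r)
      \<le> measure lebesgue ((\<Union>m. ?B m) \<union> (\<Union>i\<in>I. sphere (l i) r))"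
    using lmI neg lmU
    by (intro measure_mono_fmeasurable) (auto intro: fmeasurable.Un negligible_imp_measurable fmeasurableD)
  also have "\<dots> \<le> measure lebesgue (\<Union>m. ?B m) + measure lebesgue (\<Union>i\<in>I. sphere (l i) r)"
    using lmI neg by (intro measure_Un_le) (auto intro: fmeasurableD negligible_imp_sets)
  also have "\<dots> \<le> V" using leV neg negligible_imp_measure0 by force
  finally show ?thesis by (simp add: union_vol_def)
qed

lemma union_vol_min_attained:
  assumes r: "r > 0" and I: "finite I"
    and ex: "\<exists>c :: nat \<Rightarrow> 'a::euclidean_space. sep_on I c"
  obtains c :: "nat \<Rightarrow> 'a::euclidean_space" where "sep_on I c" "\<And>c' :: nat \<Rightarrow> 'a::euclidean_space. sep_on I c' \<Longrightarrow> union_vol r I c \<le> union_vol r I c'"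
proof -
  let ?X = "union_vol r I ` {c :: nat \<Rightarrow> 'a. sep_on I c}"
  have bdd: "bdd_below ?X" by (rule bdd_belowI[of _ 0]) (auto simp: union_vol_def)
  have ne: "?X \<noteq> {}" using ex by blast
  obtain R where R: "\<And>c. sep_on I (c :: nat \<Rightarrow> 'a) \<Longrightarrow>
      \<exists>c' :: nat \<Rightarrow> 'a. sep_on I c' \<and> c' ` I \<subseteq> cball 0 R \<and> union_vol r I c' \<le> union_vol r I c"
  proof -
    from packing_bounded_replacement[OF r, of "card I", where 'a='a] obtain R where
      "\<forall>J c. finite J \<and> card J = card I \<and> sep_on J (c :: nat \<Rightarrow> 'a) \<longrightarrow>
        (\<exists>c' :: nat \<Rightarrow> 'a. sep_on J c' \<and> c' ` J \<subseteq> cball 0 R \<and> union_vol r J c' \<le> union_vol r J c)" ..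
    with I show ?thesis by (intro that[of R]) simp
  qed
  have "\<exists>c :: nat \<Rightarrow> 'a. sep_on I c \<and> c ` I \<subseteq> cball 0 R \<and> union_vol r I c < Inf ?X + inverse (real (Suc k))" for k
  proof -
    have "Inf ?X < Inf ?X + inverse (real (Suc k))" by simp
    then obtain c :: "nat \<Rightarrow> 'a" where "sep_on I c" "union_vol r I c < Inf ?X + inverse (real (Suc k))"
      using cInf_less_iff[OF ne bdd] by blast
    then show ?thesis using R[of c] by (meson le_less_trans)
  qed
  then obtain f :: "nat \<Rightarrow> nat \<Rightarrow> 'a" where f: "\<And>k. sep_on I (f k)" "\<And>k. f k ` I \<subseteq> cball 0 R"
    "\<And>k. union_vol r I (f k) < Inf ?X + inverse (real (Suc k))"
    by metis
  have "f k i \<in> cball 0 R" if "i \<in> I" for i k using f(2)[of k] that by blast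
  from bounded_seq_family_subseq[where f=f, OF I this] obtain s l where
    s: "strict_mono s" and l: "\<forall>i\<in>I. (\<lambda>k. f (s k) i) \<longlonglongrightarrow> l i"
    by blast
  have "(\<lambda>k. union_vol r I (f k)) \<longlonglongrightarrow> Inf ?X"
  proof (rule tendsto_sandwich[OF _ _ tendsto_const])
    show "(\<lambda>k. Inf ?X + inverse (real (Suc k))) \<longlonglongrightarrow> Inf ?X"
      using tendsto_add[OF tendsto_const LIMSEQ_inverse_real_of_nat] by simp
    show "\<forall>\<^sub>F k in sequentially. Inf ?X \<le> union_vol r I (f k)"
      using f(1) bdd by (intro always_eventually allI cInf_lower) auto
    show "\<forall>\<^sub>F k in sequentially. union_vol r I (f k) \<le> Inf ?X + inverse (real (Suc k))"
      using f(3) less_imp_le by (intro always_eventually) blast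
  qed
  from LIMSEQ_subseq_LIMSEQ[OF this s]
  have V: "(\<lambda>k. union_vol r I (f (s k))) \<longlonglongrightarrow> Inf ?X" by (simp add: o_def)
  have "union_vol r I l \<le> Inf ?X"
    by (rule union_vol_lower_limit[OF I _ V r]) (use l in blast)
  moreover have "sep_on I l"
    unfolding sep_on_def
  proof (intro ballI impI)
    fix j k assume jk: "j \<in> I" "k \<in> I" "j \<noteq> k"
    have "(\<lambda>m. dist (f (s m) j) (f (s m) k)) \<longlonglongrightarrow> dist (l j) (l k)"
      using l jk by (intro tendsto_dist) auto
    then show "2 \<le> dist (l j) (l k)"
      by (rule LIMSEQ_le_const) (use f(1) jk in \<open>auto simp: sep_on_def\<close>)
  qed
  moreover have "Inf ?X \<le> union_vol r I c'" if "sep_on I c'" for c' :: "nat \<Rightarrow> 'a"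
    using that bdd by (intro cInf_lower) auto
  ultimately show ?thesis using that[of l] by (meson order_trans)
qed

lemma ex_sep_on: "\<exists>c :: nat \<Rightarrow> 'a::euclidean_space. sep_on I c"
proof -
  obtain v :: 'a where v: "norm v = 2" using vector_choose_size[of 2] by auto
  have "2 \<le> dist (real j *\<^sub>R v) (real k *\<^sub>R v)" if "j \<noteq> k" for j k :: nat
  proof -
    have "1 \<le> \<bar>real j - real k\<bar>" using that by linarith
    then show ?thesis using v by (simp add: dist_norm flip: scaleR_left_diff_distrib)
  qed
  then show ?thesis unfolding sep_on_def by (intro exI[of _ "\<lambda>i. real i *\<^sub>R v"]) simp
qed

lemma soft_packing_density_attained:
  assumes "n > 1" "lam > 0"
  obtains c :: "nat \<Rightarrow> 'a::euclidean_space" where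
    "unit_ball_packing n c"
    "soft_packing_density TYPE('a::euclidean_space) n lam = soft_density n lam c"
    "\<And>c' :: nat \<Rightarrow> 'a::euclidean_space. unit_ball_packing n c' \<Longrightarrow> soft_density n lam c' \<le> soft_density n lam c"
proof -
  have "1 + lam > 0" using assms by simp
  then obtain c :: "nat \<Rightarrow> 'a" where c: "sep_on {1..n} c"
    "\<And>c' :: nat \<Rightarrow> 'a. sep_on {1..n} c' \<Longrightarrow> union_vol (1 + lam) {1..n} c \<le> union_vol (1 + lam) {1..n} c'"
    using union_vol_min_attained[of "1 + lam" "{1..n}"] ex_sep_on by (metis finite_atLeastAtMost)
  have pos: "union_vol (1 + lam) {1..n} c > 0"
  proof -
    have "0 < measure lebesgue (cball (c 1) (1 + lam))"
      using content_cball_pos[of "1 + lam" "c 1"] assms by (simp add: measure_completion)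
    also have "\<dots> \<le> union_vol (1 + lam) {1..n} c" unfolding union_vol_def
      using assms by (intro measure_mono_fmeasurable lmeasurable_union_cball UN_upper) auto
    finally show ?thesis .
  qed
  have max: "soft_density n lam c' \<le> soft_density n lam c" if "unit_ball_packing n c'" for c' :: "nat \<Rightarrow> 'a"
    unfolding soft_density_def union_vol_def[symmetric]
    using that c(2)[of c'] pos
    by (intro divide_left_mono mult_nonneg_nonneg mult_pos_pos) (auto simp: unit_ball_packing_iff)
  have pc: "unit_ball_packing n c" using c(1) assms by (simp add: unit_ball_packing_iff)
  have "soft_packing_density TYPE('a) n lam = soft_density n lam c"
    unfolding soft_packing_density_def
    using pc max by (intro Greatest_equality) auto
  then show ?thesis using that pc max by blast
qed

end

theory Submission
  imports Defs
begin

text \<open>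
  Blichfeldt's method. If the points \<open>c\<^sub>i\<close>, \<open>i \<in> J\<close>, are pairwise at distance at least 2, then
  \<open>\<Sum>\<^sub>i (2 - |x - c\<^sub>i|\<^sup>2) \<le> 2\<close> for every \<open>x\<close>, because \<open>|J| \<Sum>\<^sub>i |x - c\<^sub>i|\<^sup>2\<close> dominates the sum of the
  squared mutual distances. Apply this at each \<open>x\<close> to the set \<open>J\<close> of those \<open>i\<close> with
  \<open>|x - c\<^sub>i| \<le> 1 + \<lambda>\<close>, and integrate over the union of the enlarged balls.
\<close>

section \<open>Blichfeldt's pointwise inequality\<close>

lemma sum_sum_norm_diff_power2:
  fixes y :: "'i \<Rightarrow> 'a::real_inner"
  shows "(\<Sum>i\<in>J. \<Sum>j\<in>J. (norm (y i - y j))\<^sup>2)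
    = 2 * real (card J) * (\<Sum>i\<in>J. (norm (y i))\<^sup>2) - 2 * (norm (\<Sum>i\<in>J. y i))\<^sup>2"
proof -
  have "(norm (y i - y j))\<^sup>2 = (norm (y i))\<^sup>2 + (norm (y j))\<^sup>2 - 2 * (y i \<bullet> y j)" for i j
    by (simp add: power2_norm_eq_inner inner_diff inner_commute)
  moreover have "(norm (\<Sum>i\<in>J. y i))\<^sup>2 = (\<Sum>i\<in>J. \<Sum>j\<in>J. y i \<bullet> y j)"
    unfolding power2_norm_eq_inner inner_sum_left inner_sum_right by (rule sum.swap)
  ultimately show ?thesis
    by (simp add: sum.distrib sum_subtractf flip: sum_distrib_left)
qed

lemma blichfeldt_inequality:
  fixes c :: "nat \<Rightarrow> 'a::euclidean_space"
  assumes J: "finite J" and sep: "sep_on J c"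
  shows "(\<Sum>i\<in>J. 2 - (norm (x - c i))\<^sup>2) \<le> 2"
proof (cases "J = {}")
  case False
  define k where "k = real (card J)"
  have k: "k > 0" using False J by (simp add: k_def card_gt_0_iff)
  define S where "S = (\<Sum>i\<in>J. (norm (x - c i))\<^sup>2)"
  \<comment> \<open>Diagonal pairs contribute 0, so each row has \<open>k - 1\<close> entries of at
    least 2 squared.\<close>
  have row: "(\<Sum>j\<in>J. if j = i then 0 else 4) = 4 * (k - 1)" if "i \<in> J" for i
  proof -
    have "(\<Sum>j\<in>J. if j = i then 0 else 4) = (\<Sum>j\<in>J. 4 - (if j = i then 4 else (0::real)))"
      by (intro sum.cong) auto
    then show ?thesis using J that by (simp add: k_def sum_subtractf)
  qed
  have "4 * k * (k - 1) = (\<Sum>i\<in>J. \<Sum>j\<in>J. if j = i then 0 else 4)"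
    by (simp add: sum.cong[OF refl row] k_def)
  also have "\<dots> \<le> (\<Sum>i\<in>J. \<Sum>j\<in>J. (norm ((x - c i) - (x - c j)))\<^sup>2)"
  proof (intro sum_mono)
    fix i j assume ij: "i \<in> J" "j \<in> J"
    have "2\<^sup>2 \<le> (norm (c j - c i))\<^sup>2" if "j \<noteq> i"
      using sep ij that by (intro power_mono) (auto simp: sep_on_def dist_norm)
    then show "(if j = i then 0 else 4) \<le> (norm ((x - c i) - (x - c j)))\<^sup>2" by simp
  qed
  \<comment> \<open>The identity subtracts a multiple of a squared norm; dropping it leaves an upper
    bound.\<close>
  also have "\<dots> \<le> 2 * k * S"
    unfolding sum_sum_norm_diff_power2 k_def S_def by simp
  finally have "k * (2 * (k - 1)) \<le> k * S" by (simp add: algebra_simps)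
  then have "2 * (k - 1) \<le> S" using k by simp
  then show ?thesis by (simp add: sum_subtractf S_def k_def)
qed simp

section \<open>Volume and second moment of a ball\<close>

lemma lborel_integral_affine:
  fixes f :: "'a::euclidean_space \<Rightarrow> real" and a :: 'a
  assumes "r > 0" and [measurable]: "f \<in> borel_measurable borel"
  shows "(\<integral>x. f x \<partial>lborel) = r ^ DIM('a) * (\<integral>x. f (a + r *\<^sub>R x) \<partial>lborel)"
proof -
  have "lborel = density (distr lborel borel (\<lambda>x. a + r *\<^sub>R x)) (\<lambda>_. ennreal (r ^ DIM('a)))"
    using lborel_affine[of r a] assms(1) by (simp add: ennreal_power)
  then have "(\<integral>x. f x \<partial>lborel)
      = (\<integral>x. f x \<partial>density (distr lborel borel (\<lambda>x. a + r *\<^sub>R x)) (\<lambda>_. ennreal (r ^ DIM('a))))"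
    by metis
  also have "\<dots> = r ^ DIM('a) * (\<integral>x. f (a + r *\<^sub>R x) \<partial>lborel)"
    using assms(1) by (simp add: integral_density integral_distr)
  finally show ?thesis .
qed

definition ball_second_moment :: "'a::euclidean_space \<Rightarrow> real \<Rightarrow> real" where
  "ball_second_moment a r = (\<integral>x. indicator (cball a r) x * (norm (x - a))\<^sup>2 \<partial>lborel)"

lemma integrable_second_moment:
  "integrable lborel (\<lambda>x. indicator (cball a r) x * (norm (x - a))\<^sup>2)"
  using borel_integrable_compact[of "cball a r" "\<lambda>x. (norm (x - a))\<^sup>2"]
  by (simp add: continuous_intros)

text \<open>Substituting a + r x for x gives \<open>r ^ DIM('a)\<close> from the volume element and
  r squared from the squared norm.\<close>

lemma ball_second_moment_scale:
  fixes a :: "'a::euclidean_space"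
  assumes "r > 0"
  shows "ball_second_moment a r = r ^ (DIM('a) + 2) * ball_second_moment (0::'a) 1"
proof -
  have "ball_second_moment a r = r ^ DIM('a) *
      (\<integral>x. indicator (cball a r) (a + r *\<^sub>R x) * (norm (a + r *\<^sub>R x - a))\<^sup>2 \<partial>lborel)"
    unfolding ball_second_moment_def
    by (intro lborel_integral_affine assms borel_measurable_integrable[OF integrable_second_moment, simplified])
  also have "(\<lambda>x. indicator (cball a r) (a + r *\<^sub>R x) * (norm (a + r *\<^sub>R x - a))\<^sup>2)
      = (\<lambda>x. r\<^sup>2 * (indicator (cball (0::'a) 1) x * (norm (x - 0))\<^sup>2))"
    using assms by (auto simp: indicator_def dist_norm power_mult_distrib)
  finally show ?thesis
    unfolding ball_second_moment_def power_add by (simp only: integral_mult_right_zero mult.assoc)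
qed

lemma measure_lborel_cball_scale:
  assumes "r \<ge> 0"
  shows "measure lborel (cball (a::'a::euclidean_space) r)
    = r ^ DIM('a) * measure lborel (cball (0::'a) 1)"
  using content_cball[OF assms, of a] content_cball[of 1 "0::'a"] by simp

text \<open>
  The shell \<open>s < |x| \<le> 1\<close> has second moment between \<open>s\<^sup>2\<close> and \<open>1\<close> times its volume. By homogeneity
  its second moment is proportional to \<open>1 - s ^ (d + 2)\<close> and its volume to \<open>1 - s ^ d\<close>; dividing by
  \<open>1 - s\<close> and letting \<open>s\<close> tend to 1 gives the ratio.
\<close>
lemma ball_second_moment_unit:
  "(real DIM('a) + 2) * ball_second_moment (0::'a::euclidean_space) 1
     = real DIM('a) * measure lborel (cball (0::'a) 1)"
proof -
  let ?d = "DIM('a)"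
  define M where "M = ball_second_moment (0::'a) 1"
  define w where "w = measure lborel (cball (0::'a) 1)"
  have shell: "s\<^sup>2 * (w * (1 - s ^ ?d)) \<le> M * (1 - s ^ (?d + 2))"
    "M * (1 - s ^ (?d + 2)) \<le> w * (1 - s ^ ?d)" if s: "0 < s" "s < 1" for s
  proof -
    let ?m = "\<lambda>r x. indicator (cball (0::'a) r) x * (norm (x - 0))\<^sup>2"
    let ?v = "\<lambda>r. indicator (cball (0::'a) r) :: 'a \<Rightarrow> real"
    have iv: "integrable lborel (?v r)" for r
      by (intro integrable_real_indicator)
        (simp_all only: emeasure_compact_finite[OF compact_cball] sets_lborel borel_closed closed_cball)
    have V: "(\<integral>x. ?v 1 x - ?v s x \<partial>lborel) = w * (1 - s ^ ?d)"
      using s measure_lborel_cball_scale[of s "0::'a"]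
      by (simp add: Bochner_Integration.integral_diff[OF iv iv] w_def algebra_simps)
    have m: "(\<integral>x. ?m 1 x - ?m s x \<partial>lborel) = M * (1 - s ^ (?d + 2))"
      unfolding Bochner_Integration.integral_diff[OF integrable_second_moment integrable_second_moment]
        ball_second_moment_def[symmetric] ball_second_moment_scale[OF s(1)] M_def
      by (simp add: algebra_simps)
    have "(\<integral>x. s\<^sup>2 * (?v 1 x - ?v s x) \<partial>lborel) \<le> (\<integral>x. ?m 1 x - ?m s x \<partial>lborel)"
      using s by (intro integral_mono integrable_mult_right Bochner_Integration.integrable_diff
          integrable_second_moment iv) (auto simp: indicator_def intro!: power_mono)
    then show "s\<^sup>2 * (w * (1 - s ^ ?d)) \<le> M * (1 - s ^ (?d + 2))"
      by (simp only: V m integral_mult_right_zero)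
    have "(\<integral>x. ?m 1 x - ?m s x \<partial>lborel) \<le> (\<integral>x. ?v 1 x - ?v s x \<partial>lborel)"
      using s by (intro integral_mono Bochner_Integration.integrable_diff
          integrable_second_moment iv) (auto simp: indicator_def power_le_one)
    then show "M * (1 - s ^ (?d + 2)) \<le> w * (1 - s ^ ?d)" by (simp only: V m)
  qed
  \<comment> \<open>Up to sign in both parts, the quotient is the difference quotient of the k-th
    power at 1, so its left limit is the derivative k.\<close>
  have lim: "((\<lambda>s. (1 - s ^ k) / (1 - s)) \<longlongrightarrow> real k) (at_left (1::real))" for k
  proof -
    have "((\<lambda>s::real. s ^ k) has_field_derivative real k) (at 1 within {..<1})"
      by (auto intro!: derivative_eq_intros)
    moreover have "(1 - s ^ k) / (1 - s) = (s ^ k - 1) / (s - 1)" for s :: real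
      using minus_divide_divide[of "s ^ k - 1" "s - 1"] by simp
    ultimately show ?thesis by (simp add: has_field_derivative_iff)
  qed
  have ev: "\<forall>\<^sub>F s in at_left (1::real). 0 < s \<and> s < 1"
    by (auto simp: eventually_at_left_field intro!: exI[of _ 0])
  have lo: "((\<lambda>s. s\<^sup>2 * (w * ((1 - s ^ ?d) / (1 - s)))) \<longlongrightarrow> 1\<^sup>2 * (w * real ?d)) (at_left 1)"
    by (intro tendsto_intros lim)
  have mid: "((\<lambda>s. M * ((1 - s ^ (?d + 2)) / (1 - s))) \<longlongrightarrow> M * real (?d + 2)) (at_left 1)"
    by (intro tendsto_intros lim)
  have hi: "((\<lambda>s. w * ((1 - s ^ ?d) / (1 - s))) \<longlongrightarrow> w * real ?d) (at_left 1)"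
    by (intro tendsto_intros lim)
  \<comment> \<open>As s tends to 1, the factor \<open>s\<^sup>2\<close> tends to 1, so the lower
    and upper shell bounds have the same limit and force equality.\<close>
  have "1\<^sup>2 * (w * real ?d) \<le> M * real (?d + 2)"
  proof (rule tendsto_le[OF _ mid lo])
    show "\<forall>\<^sub>F s in at_left 1. s\<^sup>2 * (w * ((1 - s ^ ?d) / (1 - s)))
        \<le> M * ((1 - s ^ (?d + 2)) / (1 - s))"
      using ev
    proof eventually_elim
      case (elim s)
      then show ?case using divide_right_mono[OF shell(1), of s "1 - s"] by simp
    qed
  qed simp
  moreover have "M * real (?d + 2) \<le> w * real ?d"
  proof (rule tendsto_le[OF _ hi mid])
    show "\<forall>\<^sub>F s in at_left 1. M * ((1 - s ^ (?d + 2)) / (1 - s)) \<le> w * ((1 - s ^ ?d) / (1 - s))"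
      using ev
    proof eventually_elim
      case (elim s)
      then show ?case using divide_right_mono[OF shell(2), of s "1 - s"] by simp
    qed
  qed simp
  ultimately show ?thesis by (simp add: M_def w_def algebra_simps)
qed

text \<open>The total Blichfeldt weight of one ball: twice its volume minus its second moment, the
  latter known from scaling and the unit ball.\<close>

lemma integral_two_minus_norm_power2:
  fixes a :: "'a::euclidean_space"
  assumes r: "r > 0"
  shows "integrable lborel (\<lambda>x. indicator (cball a r) x * (2 - (norm (x - a))\<^sup>2))"
    and "(\<integral>x. indicator (cball a r) x * (2 - (norm (x - a))\<^sup>2) \<partial>lborel)
      = measure lborel (cball (0::'a) 1) * r ^ DIM('a)
        * ((2 - r\<^sup>2) * real DIM('a) + 4) / (real DIM('a) + 2)"
proof -
  let ?w = "measure lborel (cball (0::'a) 1)" and ?d = "real DIM('a)"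
  have eq: "(\<lambda>x. indicator (cball a r) x * (2 - (norm (x - a))\<^sup>2))
      = (\<lambda>x. 2 * indicator (cball a r) x - indicator (cball a r) x * (norm (x - a))\<^sup>2)"
    by (auto simp: algebra_simps)
  have i1: "integrable lborel (\<lambda>x. 2 * indicator (cball a r) x :: real)"
    by (intro integrable_mult_right integrable_real_indicator)
      (simp_all only: emeasure_compact_finite[OF compact_cball] sets_lborel borel_closed closed_cball)
  show "integrable lborel (\<lambda>x. indicator (cball a r) x * (2 - (norm (x - a))\<^sup>2))"
    unfolding eq by (intro Bochner_Integration.integrable_diff i1 integrable_second_moment)
  have M: "ball_second_moment (0::'a) 1 = ?d * ?w / (?d + 2)"
    using ball_second_moment_unit[where 'a='a] by (simp add: field_simps)
  have "(\<integral>x. indicator (cball a r) x * (2 - (norm (x - a))\<^sup>2) \<partial>lborel)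
      = 2 * measure lborel (cball a r) - ball_second_moment a r"
    unfolding eq Bochner_Integration.integral_diff[OF i1 integrable_second_moment]
    by (simp add: ball_second_moment_def)
  also have "\<dots> = 2 * (r ^ DIM('a) * ?w) - r ^ DIM('a) * r\<^sup>2 * (?d * ?w / (?d + 2))"
    unfolding measure_lborel_cball_scale[OF less_imp_le[OF r], of a]
      ball_second_moment_scale[OF r, of a] M power_add ..
  \<comment> \<open>Over the common denominator d + 2, the numerator is 2 (d + 2) - d r^2 = (2 -
    r^2) d + 4.\<close>
  also have "\<dots> = ?w * r ^ DIM('a) * ((2 - r\<^sup>2) * ?d + 4) / (?d + 2)"
    by (simp add: divide_simps) (simp add: algebra_simps)
  finally show "(\<integral>x. indicator (cball a r) x * (2 - (norm (x - a))\<^sup>2) \<partial>lborel)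
      = ?w * r ^ DIM('a) * ((2 - r\<^sup>2) * ?d + 4) / (?d + 2)" .
qed

section \<open>From the pointwise inequality to volume and density\<close>

text \<open>All balls carry the same total weight, and the summed weight is at most 2 on the union
  and 0 off it. Integrating and halving gives the bound.\<close>

lemma union_vol_lower_bound:
  fixes c :: "nat \<Rightarrow> 'a::euclidean_space"
  assumes I: "finite I" and sep: "sep_on I c" and r: "r > 0"
  shows "real (card I) * measure lebesgue (cball (0::'a) 1) * r ^ DIM('a)
      * ((2 - r\<^sup>2) * real DIM('a) + 4) / (2 * real DIM('a) + 4) \<le> union_vol r I c"
proof -
  let ?U = "\<Union>i\<in>I. cball (c i) r"
  let ?w = "measure lebesgue (cball (0::'a) 1)"
  let ?f = "\<lambda>i x. indicator (cball (c i) r) x * (2 - (norm (x - c i))\<^sup>2)"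
  have "compact ?U" using I by (intro compact_UN) auto
  then have fin: "emeasure lborel ?U < \<infinity>" and [measurable]: "?U \<in> sets borel"
    by (rule emeasure_compact_finite, rule borel_compact)
  have w: "measure lborel (cball (0::'a) 1) = ?w" by (simp add: measure_completion)
  have "(\<Sum>i\<in>I. ?f i x) \<le> 2 * indicator ?U x" for x
  proof (cases "x \<in> ?U")
    case True
    \<comment> \<open>The indicators keep exactly the balls containing x; separation passes to this
      subset of the indices.\<close>
    let ?J = "{i\<in>I. x \<in> cball (c i) r}"
    have "(\<Sum>i\<in>I. ?f i x) = (\<Sum>i\<in>?J. 2 - (norm (x - c i))\<^sup>2)"
      using I by (intro sum.mono_neutral_cong_right) (auto simp: indicator_def)
    also have "\<dots> \<le> 2"
      using I sep by (intro blichfeldt_inequality) (auto simp: sep_on_def)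
    finally show ?thesis using True by (simp only: indicator_simps)
  next
    case False
    then have "(\<Sum>i\<in>I. ?f i x) = 0" by (intro sum.neutral) auto
    then show ?thesis by (simp only: indicator_pos_le mult_nonneg_nonneg zero_le_numeral)
  qed
  then have "(\<integral>x. (\<Sum>i\<in>I. ?f i x) \<partial>lborel) \<le> (\<integral>x. 2 * indicator ?U x \<partial>lborel)"
    using fin by (intro integral_mono Bochner_Integration.integrable_sum
        integral_two_minus_norm_power2(1) r integrable_mult_right integrable_real_indicator) auto
  also have "\<dots> = 2 * union_vol r I c"
    using fin by (simp add: union_vol_def measure_completion)
  also have "(\<integral>x. (\<Sum>i\<in>I. ?f i x) \<partial>lborel)
      = real (card I) * (?w * r ^ DIM('a) * ((2 - r\<^sup>2) * real DIM('a) + 4) / (real DIM('a) + 2))"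
    by (subst Bochner_Integration.integral_sum)
      (simp_all only: integral_two_minus_norm_power2 r sum_constant w)
  finally show ?thesis by (simp add: field_simps)
qed

lemma soft_density_upper_bound:
  fixes c :: "nat \<Rightarrow> 'a::euclidean_space"
  assumes "unit_ball_packing n c" and lam: "1 + lam > 0" "(1 + lam)\<^sup>2 \<le> 2"
  shows "soft_density n lam c \<le> (2 * real DIM('a) + 4) / ((2 - (1 + lam)\<^sup>2) * real DIM('a) + 4)
    * (1 + lam) powi (- int DIM('a))"
proof -
  let ?d = "real DIM('a)" and ?w = "measure lebesgue (cball (0::'a) 1)"
  define A where "A = (2 - (1 + lam)\<^sup>2) * ?d + 4"
  define D where "D = 2 * ?d + 4"
  define R where "R = (1 + lam) ^ DIM('a)"
  define V where "V = union_vol (1 + lam) {1..n} c"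
  \<comment> \<open>The bound \<open>(1 + lam)\<^sup>2 \<le> 2\<close> gives A at least 4, so
    dividing by A is legitimate.\<close>
  have pos: "A > 0" "D > 0" "R > 0"
    using lam by (auto simp: A_def D_def R_def intro!: add_nonneg_pos)
  have n: "n > 1" and sep: "sep_on {1..n} c"
    using assms(1) by (auto simp: unit_ball_packing_iff)
  have "?w > 0"
    using content_cball_pos[of 1 "0::'a"] by (simp add: measure_completion)
  then have nw: "0 < real n * ?w" using n by simp
  have le: "real n * ?w * R * A / D \<le> V"
    using union_vol_lower_bound[OF finite_atLeastAtMost sep lam(1)]
    by (simp add: V_def A_def D_def R_def)
  moreover have "0 < real n * ?w * R * A / D" using nw pos by simp
  ultimately have "V > 0" by linarith
  then have "real n * ?w / V \<le> D / A * inverse R"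
    using le pos by (simp add: field_simps)
  then show ?thesis
    by (simp add: soft_density_def union_vol_def V_def A_def D_def R_def power_int_minus)
qed

text \<open>An upper limit ignores finitely many terms. With N = 1 this discards n = 0 and n = 1,
  where no packing exists and the \<open>GREATEST\<close> in the density is unspecified.\<close>

lemma limsup_ereal_le_SUP_greaterThan:
  fixes f :: "nat \<Rightarrow> ereal"
  shows "limsup f \<le> (SUP n\<in>{n. n > N}. f n)"
  by (rule Limsup_bounded) (auto simp: eventually_sequentially intro!: exI[of _ "Suc N"] SUP_upper)

theorem theorem2:
  fixes d :: nat and lam :: real
  assumes "d = DIM('a::euclidean_space)" and "d \<ge> 2"
    and "root d (real d) - 1 \<le> lam" and "lam \<le> sqrt 2 - 1"
  shows "soft_packing_limit_density TYPE('a) lam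
           \<le> (SUP n\<in>{n. n > 1}. ereal (soft_packing_density TYPE('a) n lam))
       \<and> (SUP n\<in>{n. n > 1}. ereal (soft_packing_density TYPE('a) n lam))
           \<le> ereal ((2 * real d + 4) / ((2 - (1 + lam)^2) * real d + 4) * (1 + lam) powi (- int d))
       \<and> (2 * real d + 4) / ((2 - (1 + lam)^2) * real d + 4) * (1 + lam) powi (- int d)
           \<le> (real d + 2) / 2 * (1 + lam) powi (- int d)
       \<and> (real d + 2) / 2 * (1 + lam) powi (- int d) \<le> 1"
proof (intro conjI)
  \<comment> \<open>This makes lam positive, as required for the maximal density to be
    attained.\<close>
  have root_gt: "root d (real d) > 1" using assms(2) by simp
  then have lam: "lam > 0" using assms(3) by simp
  have "(1 + lam)\<^sup>2 \<le> (sqrt 2)\<^sup>2" using assms(4) lam by (intro power_mono) auto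
  then have sq: "(1 + lam)\<^sup>2 \<le> 2" by simp
  have "root d (real d) ^ d \<le> (1 + lam) ^ d"
    using assms(3) root_gt by (intro power_mono) auto
  then have dle: "real d \<le> (1 + lam) ^ d" using assms(2) by simp
  show "soft_packing_limit_density TYPE('a) lam
      \<le> (SUP n\<in>{n. n > 1}. ereal (soft_packing_density TYPE('a) n lam))"
    unfolding soft_packing_limit_density_def by (rule limsup_ereal_le_SUP_greaterThan)
  show "(SUP n\<in>{n. n > 1}. ereal (soft_packing_density TYPE('a) n lam))
      \<le> ereal ((2 * real d + 4) / ((2 - (1 + lam)^2) * real d + 4) * (1 + lam) powi (- int d))"
  proof (rule SUP_least)
    \<comment> \<open>The maximum is the density of an actual packing c, so the bound for a single
      packing applies.\<close>
    fix n :: nat assume "n \<in> {n. n > 1}"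
    then obtain c :: "nat \<Rightarrow> 'a" where "unit_ball_packing n c"
      "soft_packing_density TYPE('a) n lam = soft_density n lam c"
      using soft_packing_density_attained[OF _ lam] by blast
    then show "ereal (soft_packing_density TYPE('a) n lam)
        \<le> ereal ((2 * real d + 4) / ((2 - (1 + lam)^2) * real d + 4) * (1 + lam) powi (- int d))"
      using soft_density_upper_bound[of n c lam] lam sq assms(1) by simp
  qed
  \<comment> \<open>The term multiplied by d in the denominator is nonnegative, so the denominator
    is at least 4.\<close>
  have "(2 * real d + 4) / ((2 - (1 + lam)\<^sup>2) * real d + 4) \<le> (2 * real d + 4) / 4"
    using sq by (intro divide_left_mono) (auto intro!: mult_pos_pos add_nonneg_pos)
  also have "\<dots> = (real d + 2) / 2" by simp
  finally show "(2 * real d + 4) / ((2 - (1 + lam)^2) * real d + 4) * (1 + lam) powi (- int d)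
      \<le> (real d + 2) / 2 * (1 + lam) powi (- int d)"
    using lam by (intro mult_right_mono) auto
  \<comment> \<open>Since d is at least 2, (d + 2) / 2 is at most d, which the lower bound on lam
    puts below \<open>(1 + lam) ^ d\<close>.\<close>
  have "(real d + 2) / 2 \<le> (1 + lam) ^ d" using dle assms(2) by simp
  then show "(real d + 2) / 2 * (1 + lam) powi (- int d) \<le> 1"
    using lam by (simp add: power_int_minus field_simps)
qed

end
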